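(* Let $\Omega$ be a set of nonzero $n$-tuples over $\{0,1\}$ such that $s(\beta)=k$ for every $\beta\in\Omega$ (a fixed $k$). Then for the graph $NEPS(P_{3},\ldots,P_{3};\Omega)$ at time $\tau_{k}$: (I) if $\sum_{\beta\in\Omega}\beta_{j}\neq 0$ in $\mathbb{Z}_{2}$ for some $j$, the graph exhibits perfect state transfer between $U_{j}$ and $V_{j}$; (II) if $\sum_{\beta\in\Omega}\beta_{j}=0$ in $\mathbb{Z}_{2}$ for some $j$, the graph is periodic at the vertices $U_{j}$ and $V_{j}$; (III) the graph is periodic at the vertex $(2,\ldots,2)$.
   Context: $P_{3}$ is the path with vertices $1,2,3$ where $1$ and $3$ are adjacent to $2$. For a set $\Omega$ of nonzero $n$-tuples $\beta=(\beta_{1},\ldots,\beta_{n})\in\{0,1\}^{n}$, $NEPS(P_{3},\ldots,P_{3};\Omega)$ ($n$ factors) has vertex set $\{1,2,3\}^{n}$, and $(x_{i})$, $(y_{i})$ are adjacent iff for some $\beta\in\Omega$, $x_{i}=y_{i}$ whenever $\beta_{i}=0$ and $x_{i}$ is adjacent to $y_{i}$ in $P_{3}$ whenever $\beta_{i}=1$. For a graph with adjacency matrix $A$, $H_{A}(t)=\exp(-itA)$; the graph has perfect state transfer from $u$ to $v$ at time $\tau$ if $|e_{u}^{T}H_{A}(\tau)e_{v}|=1$, and is periodic at $u$ at time $\tau$ if $|e_{u}^{T}H_{A}(\tau)e_{u}|=1$. $s(\beta)$ is the number of nonzero entries of $\beta$, and $\tau_{k}=\pi/(\sqrt{2})^{k}$.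 $U_{j}$ (resp. $V_{j}$) is the vertex whose $j$-th entry is $1$ (resp. $3$) and all other entries are $2$. *)

theory Defs
  imports "HOL-Analysis.Analysis" "HOL-Library.Z2"
begin

text \<open>A graph is given by a finite vertex type and its adjacency relation. Tuples are vectors
  indexed by a finite type \<open>'n\<close>, so \<open>n\<close> is \<open>CARD('n)\<close>.\<close>

definition adjacency_matrix :: "('v::finite \<Rightarrow> 'v \<Rightarrow> bool) \<Rightarrow> complex^'v^'v" where
  "adjacency_matrix E = (\<chi> u v. if E u v then 1 else 0)"

definition mat_power :: "complex^'v^'v \<Rightarrow> nat \<Rightarrow> complex^'v::finite^'v" where
  "mat_power M m = (((**) M) ^^ m) (mat 1)"

text \<open>The library operations \<open>*\<close>, \<open>^\<close> act componentwise on vectors, and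
  \<open>exp\<close> is not available for this type; hence the explicit power series with respect to \<open>**\<close>.\<close>

definition mat_exp :: "complex^'v^'v \<Rightarrow> complex^'v::finite^'v" where
  "mat_exp M = (\<Sum>m. (1 / fact m) *\<^sub>R mat_power M m)"

definition transition_matrix :: "('v::finite \<Rightarrow> 'v \<Rightarrow> bool) \<Rightarrow> real \<Rightarrow> complex^'v^'v" where
  "transition_matrix E t = mat_exp (\<chi> u v. - \<i> * complex_of_real t * adjacency_matrix E $ u $ v)"

text \<open>The scalar \<open>e\<^sub>u\<^sup>T H e\<^sub>v\<close>; the pairing is bilinear, without conjugation.\<close>

definition matrix_coeff :: "complex^'v^'v \<Rightarrow> 'v::finite \<Rightarrow> 'v \<Rightarrow> complex" where
  "matrix_coeff H u v = (\<Sum>w\<in>UNIV. axis u 1 $ w * (H *v axis v 1) $ w)"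

definition perfect_state_transfer ::
    "('v::finite \<Rightarrow> 'v \<Rightarrow> bool) \<Rightarrow> 'v \<Rightarrow> 'v \<Rightarrow> real \<Rightarrow> bool" where
  "perfect_state_transfer E u v \<tau> \<longleftrightarrow> norm (matrix_coeff (transition_matrix E \<tau>) u v) = 1"

definition periodic_at :: "('v::finite \<Rightarrow> 'v \<Rightarrow> bool) \<Rightarrow> 'v \<Rightarrow> real \<Rightarrow> bool" where
  "periodic_at E u \<tau> \<longleftrightarrow> norm (matrix_coeff (transition_matrix E \<tau>) u u) = 1"

lemma matrix_coeff_eq: "matrix_coeff H u v = H $ u $ v"
proof -
  have "(H *v axis v 1) $ w = H $ w $ v" for w
    by (simp add: matrix_vector_mult_def axis_def if_distrib cong: if_cong)
  then have "matrix_coeff H u v = (\<Sum>w\<in>UNIV. if w = u then H $ w $ v else 0)"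
    unfolding matrix_coeff_def by (intro sum.cong) (auto simp: axis_def)
  then show ?thesis by simp
qed

lemma summable_mat_exp:
  fixes M :: "complex^'v::finite^'v"
  shows "summable (\<lambda>m. (1 / fact m) *\<^sub>R mat_power M m)"
proof -
  define C where "C = (\<Sum>i\<in>UNIV. \<Sum>j\<in>UNIV. norm (M $ i $ j))"
  have C0: "0 \<le> C" unfolding C_def by (intro sum_nonneg) auto
  have row: "(\<Sum>l\<in>UNIV. norm (M $ i $ l)) \<le> C" for i
    unfolding C_def by (rule member_le_sum) (auto intro: sum_nonneg)
  have entry: "norm (mat_power M m $ i $ j) \<le> C ^ m" for m i j
  proof (induction m arbitrary: i j)
    case 0
    then show ?case by (simp add: mat_power_def mat_def)
  next
    case (Suc m)
    have "norm (mat_power M (Suc m) $ i $ j) \<le> (\<Sum>l\<in>UNIV. norm (M $ i $ l * mat_power M m $ l $ j))"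
      by (simp add: mat_power_def matrix_matrix_mult_def) (rule norm_sum)
    also have "\<dots> \<le> (\<Sum>l\<in>UNIV. norm (M $ i $ l) * C ^ m)"
      by (intro sum_mono) (simp add: norm_mult mult_left_mono Suc.IH)
    also have "\<dots> \<le> C * C ^ m"
      using row C0 by (simp flip: sum_distrib_right add: mult_right_mono)
    finally show ?case by simp
  qed
  have "norm (mat_power M m) \<le> real CARD('v) * (real CARD('v) * C ^ m)" for m
  proof -
    have r: "norm (mat_power M m $ i) \<le> real CARD('v) * C ^ m" for i
      using norm_le_l1_cart[of "\<chi> j. norm (mat_power M m $ i $ j)"]
        L2_set_le_sum[of UNIV "\<lambda>j. norm (mat_power M m $ i $ j)"]
        sum_bounded_above[of UNIV "\<lambda>j. norm (mat_power M m $ i $ j)" "C ^ m"] entry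
      by (fastforce simp: norm_vec_def intro: order_trans)
    have "norm (mat_power M m) \<le> (\<Sum>i\<in>UNIV. norm (mat_power M m $ i))"
      by (simp add: norm_vec_def[of "mat_power M m"] L2_set_le_sum)
    also have "\<dots> \<le> of_nat (card (UNIV :: 'v set)) * (real CARD('v) * C ^ m)"
      by (intro sum_bounded_above r)
    finally show ?thesis .
  qed
  then have "norm ((1 / fact m) *\<^sub>R mat_power M m)
      \<le> real CARD('v) * real CARD('v) * (inverse (fact m) * C ^ m)" for m
    using mult_left_mono[of "norm (mat_power M m)" _ "inverse (fact m)"]
    by (simp add: divide_inverse mult_ac)
  moreover have "summable (\<lambda>m. real CARD('v) * real CARD('v) * (inverse (fact m) * C ^ m))"
    by (intro summable_mult summable_exp)
  ultimately show ?thesis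
    by (rule summable_comparison_test'[rotated])
qed

instance bit :: finite
proof
  have "(UNIV :: bit set) = {0, 1}" by (auto simp: bit_not_zero_iff)
  then show "finite (UNIV :: bit set)" by (metis finite.emptyI finite_insert)
qed

text \<open>In the type \<open>3\<close> the numeral \<open>3\<close> equals \<open>0\<close>; its elements are exactly
  the three distinct values \<open>1\<close>, \<open>2\<close>, \<open>3\<close>.\<close>

definition P3 :: "3 \<Rightarrow> 3 \<Rightarrow> bool" where
  "P3 x y \<longleftrightarrow> (x = 2 \<and> (y = 1 \<or> y = 3)) \<or> ((x = 1 \<or> x = 3) \<and> y = 2)"

definition NEPS :: "('n::finite \<Rightarrow> 'v \<Rightarrow> 'v \<Rightarrow> bool) \<Rightarrow> (bit^'n) set \<Rightarrow> 'v^'n \<Rightarrow> 'v^'n \<Rightarrow> bool" where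
  "NEPS G \<Omega> x y \<longleftrightarrow> (\<exists>\<beta>\<in>\<Omega>. \<forall>i. (\<beta> $ i = 0 \<longrightarrow> x $ i = y $ i) \<and> (\<beta> $ i = 1 \<longrightarrow> G i (x $ i) (y $ i)))"

definition weight :: "bit^'n::finite \<Rightarrow> nat" where
  "weight \<beta> = card {i. \<beta> $ i \<noteq> 0}"

definition U_vertex :: "'n::finite \<Rightarrow> 3^'n" where
  "U_vertex j = (\<chi> i. if i = j then 1 else 2)"

definition V_vertex :: "'n::finite \<Rightarrow> 3^'n" where
  "V_vertex j = (\<chi> i. if i = j then 3 else 2)"

lemma NEPS_P3_sym: "NEPS (\<lambda>_. P3) \<Omega> x y \<Longrightarrow> NEPS (\<lambda>_. P3) \<Omega> y x"
  unfolding NEPS_def P3_def by metis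

lemma NEPS_P3_irrefl:
  assumes "0 \<notin> \<Omega>"
  shows "\<not> NEPS (\<lambda>_. P3) \<Omega> x x"
proof
  assume "NEPS (\<lambda>_. P3) \<Omega> x x"
  then obtain \<beta> where \<beta>: "\<beta> \<in> \<Omega>" "\<And>i. \<beta> $ i = 1 \<longrightarrow> P3 (x $ i) (x $ i)"
    unfolding NEPS_def by blast
  have "\<not> P3 a a" for a by (auto simp: P3_def)
  with \<beta>(2) have "\<beta> = 0" by (simp add: vec_eq_iff bit_not_one_iff)
  with \<beta>(1) assms show False by simp
qed

end

theory Submission
  imports Defs
begin

text \<open>
  The tensor product of eigenvectors of the factors, with eigenvalues \<open>\<mu> i\<close>, is an eigenvector of
  the NEPS with eigenvalue \<open>\<Sum>\<beta>\<in>\<Omega>. \<Prod>i | \<beta>\<^sub>i = 1. \<mu> i\<close>. The path \<open>P3\<close> has eigenvalues \<open>\<surd>2 s\<close> for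
  \<open>s \<in> {-1, 0, 1}\<close>, so if all \<open>\<beta>\<close> have weight \<open>k\<close>, the eigenvalues of the NEPS are \<open>\<surd>2\<^sup>k N\<close> with
  integers \<open>N\<close>, and at time \<open>\<pi> / \<surd>2\<^sup>k\<close> the phase is \<open>(-1)\<^sup>N\<close>. The basis vector of \<open>(2,\<dots>,2)\<close> and
  \<open>e\<^sub>U + e\<^sub>V\<close> are combinations of eigenvectors with \<open>s\<^sub>i = \<plusminus>1\<close> for all \<open>i\<close>, whereas \<open>e\<^sub>U - e\<^sub>V\<close> only
  involves those with \<open>s\<^sub>j = 0\<close> and \<open>s\<^sub>i = \<plusminus>1\<close> for \<open>i \<noteq> j\<close>. In both cases the parity of \<open>N\<close> is
  constant: it is that of \<open>card \<Omega>\<close>, respectively of the number of \<open>\<beta>\<close> with \<open>\<beta>\<^sub>j = 0\<close>. Whether the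
  two phases agree decides between periodicity and perfect state transfer.
\<close>

section \<open>Exponentials on eigenvectors\<close>

lemma mat_power_eigenvector:
  assumes "M *v x = c *s x"
  shows "mat_power M m *v x = c ^ m *s x"
proof (induction m)
  case 0
  then show ?case by (simp add: mat_power_def)
next
  case (Suc m)
  have "mat_power M (Suc m) *v x = M *v (mat_power M m *v x)"
    by (simp add: mat_power_def matrix_vector_mul_assoc)
  also have "\<dots> = c ^ Suc m *s x"
    by (simp add: Suc.IH vector_scalar_commute assms mult.commute)
  finally show ?case .
qed

text \<open>In finite dimension both \<open>A \<mapsto> A *v x\<close> and
  \<open>a \<mapsto> a *s x\<close> are bounded linear, so they pass through the exponential series,
  which then agree term by term.\<close>

lemma mat_exp_eigenvector:
  assumes "M *v x = c *s x"
  shows "mat_exp M *v x = exp c *s x"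
proof -
  have "linear (\<lambda>A :: complex^'a^'a. A *v x)"
    by (rule linearI)
      (simp_all add: vec_eq_iff matrix_vector_mult_def sum.distrib distrib_right scaleR_sum_right)
  then have "bounded_linear (\<lambda>A :: complex^'a^'a. A *v x)"
    by (simp add: linear_conv_bounded_linear)
  from bounded_linear.sums[OF this summable_sums[OF summable_mat_exp[of M]]]
  have 1: "(\<lambda>m. ((1 / fact m) *\<^sub>R mat_power M m) *v x) sums (mat_exp M *v x)"
    by (simp add: mat_exp_def)
  have "linear (\<lambda>a. a *s x)"
    by (rule linearI) (simp_all add: vec_eq_iff distrib_right)
  then have "bounded_linear (\<lambda>a. a *s x)"
    by (simp add: linear_conv_bounded_linear)
  from bounded_linear.sums[OF this exp_converges[of c]]
  have 2: "(\<lambda>m. (c ^ m /\<^sub>R fact m) *s x) sums (exp c *s x)" .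
  have "((1 / fact m) *\<^sub>R mat_power M m) *v x = (c ^ m /\<^sub>R fact m) *s x" for m
  proof -
    have "((1 / fact m) *\<^sub>R mat_power M m) *v x = (1 / fact m) *\<^sub>R (mat_power M m *v x)"
      by (simp add: vec_eq_iff matrix_vector_mult_def scaleR_sum_right)
    also have "\<dots> = (c ^ m /\<^sub>R fact m) *s x"
      by (simp add: mat_power_eigenvector[OF assms] vec_eq_iff divide_inverse)
    finally show ?thesis .
  qed
  with 1 2 show ?thesis by (simp add: sums_iff)
qed

lemma transition_matrix_eigenvector:
  assumes "adjacency_matrix E *v x = c *s x"
  shows "transition_matrix E t *v x = exp (- \<i> * complex_of_real t * c) *s x"
  unfolding transition_matrix_def
proof (rule mat_exp_eigenvector)
  show "(\<chi> u v. - \<i> * complex_of_real t * adjacency_matrix E $ u $ v) *v x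
      = (- \<i> * complex_of_real t * c) *s x"
    using arg_cong[OF assms, of "\<lambda>y. (- \<i> * complex_of_real t) *s y"]
    by (simp add: vec_eq_iff matrix_vector_mult_def sum_distrib_left sum_negf mult.assoc)
qed

lemma matrix_vector_mult_sum_scaled:
  fixes A :: "complex^'m::finite^'k"
  assumes "\<And>s. s \<in> I \<Longrightarrow> A *v v s = c *s w s"
  shows "A *v (\<Sum>s\<in>I. a s *s v s) = c *s (\<Sum>s\<in>I. a s *s w s)"
proof (cases "finite I")
  case True
  then show ?thesis using assms
    by (induction I) (simp_all add: matrix_vector_right_distrib vector_scalar_commute
        vector_add_ldistrib mult.commute)
qed simp

section \<open>Tensor products as eigenvectors of a NEPS\<close>

definition tensor :: "('n::finite \<Rightarrow> 'v \<Rightarrow> complex) \<Rightarrow> complex^('v::finite^'n)" where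
  "tensor f = (\<chi> x. \<Prod>i\<in>UNIV. f i (x $ i))"

lemma sum_vec_prod:
  fixes f :: "'n::finite \<Rightarrow> 'v::finite \<Rightarrow> 'c::comm_semiring_1"
  shows "(\<Sum>y\<in>(UNIV :: ('v^'n) set). \<Prod>i\<in>UNIV. f i (y $ i)) = (\<Prod>i\<in>UNIV. \<Sum>a\<in>UNIV. f i a)"
proof -
  have "(\<Prod>i\<in>UNIV. \<Sum>a\<in>UNIV. f i a) = (\<Sum>g\<in>UNIV. \<Prod>i\<in>UNIV. f i (g i))"
    by (subst prod_sum_PiE) (simp_all add: PiE_UNIV_domain)
  also have "\<dots> = (\<Sum>y\<in>(UNIV :: ('v^'n) set). \<Prod>i\<in>UNIV. f i (y $ i))"
    by (rule sum.reindex_bij_witness[of _ vec_nth vec_lambda]) auto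
  finally show ?thesis by simp
qed

text \<open>Multilinearity: expanding every factor leaves one term for each choice function
  \<open>s\<close>.\<close>

lemma tensor_sum:
  assumes "\<And>i. finite (S i)"
  shows "tensor (\<lambda>i x. \<Sum>s\<in>S i. a i s * p i s x)
       = (\<Sum>s\<in>PiE UNIV S. (\<Prod>i\<in>UNIV. a i (s i)) *s tensor (\<lambda>i. p i (s i)))"
  using assms by (simp add: vec_eq_iff tensor_def prod_sum_PiE prod.distrib)

text \<open>The adjacency matrix is a sum of Kronecker products. Irreflexivity forces the support of
  a witnessing \<open>\<beta>\<close> to be the set of positions where \<open>x\<close> and
  \<open>y\<close> differ, so at most one summand is 1 and no edge is counted twice.\<close>

lemma adjacency_matrix_NEPS:
  fixes G :: "'n::finite \<Rightarrow> 'v::finite \<Rightarrow> 'v \<Rightarrow> bool"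
  assumes irrefl: "\<And>i a. \<not> G i a a"
  shows "adjacency_matrix (NEPS G \<Omega>) $ x $ y
    = (\<Sum>\<beta>\<in>\<Omega>. \<Prod>i\<in>UNIV. (if \<beta> $ i = 0 then mat 1 else adjacency_matrix (G i)) $ (x $ i) $ (y $ i))"
proof -
  define T where "T \<beta> \<longleftrightarrow>
    (\<forall>i. (\<beta> $ i = 0 \<longrightarrow> x $ i = y $ i) \<and> (\<beta> $ i = 1 \<longrightarrow> G i (x $ i) (y $ i)))" for \<beta> :: "bit^'n"
  have NEPS_iff: "NEPS G \<Omega> x y \<longleftrightarrow> (\<exists>\<beta>\<in>\<Omega>. T \<beta>)"
    by (simp only: NEPS_def T_def)
  \<comment> \<open>The indicator of the differing positions, the only possible witness.\<close>
  define \<gamma> :: "bit^'n" where "\<gamma> = (\<chi> i. if x $ i = y $ i then 0 else 1)"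
  have T_unique: "\<beta> = \<gamma>" if "T \<beta>" for \<beta>
  proof -
    have "\<beta> $ i = \<gamma> $ i" for i
      using that irrefl[of i "y $ i"] by (cases "\<beta> $ i") (auto simp: T_def \<gamma>_def)
    then show ?thesis by (simp add: vec_eq_iff)
  qed
  have "(\<Prod>i\<in>UNIV. (if \<beta> $ i = 0 then mat 1 else adjacency_matrix (G i)) $ (x $ i) $ (y $ i))
      = of_bool (T \<beta>)" for \<beta>
  proof (cases "T \<beta>")
    case True
    then have "(if \<beta> $ i = 0 then mat 1 else adjacency_matrix (G i)) $ (x $ i) $ (y $ i) = 1" for i
      by (auto simp: T_def mat_def adjacency_matrix_def)
    with True show ?thesis by simp
  next
    case False
    then obtain i where
      "\<beta> $ i = 0 \<and> x $ i \<noteq> y $ i \<or> \<beta> $ i = 1 \<and> \<not> G i (x $ i) (y $ i)"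
      unfolding T_def by blast
    then have "(if \<beta> $ i = 0 then mat 1 else adjacency_matrix (G i)) $ (x $ i) $ (y $ i) = 0"
      by (auto simp: mat_def adjacency_matrix_def)
    then have "\<exists>i\<in>UNIV. (if \<beta> $ i = 0 then mat 1 else adjacency_matrix (G i)) $ (x $ i) $ (y $ i) = 0"
      by blast
    with False show ?thesis by (simp add: prod_zero)
  qed
  then have "(\<Sum>\<beta>\<in>\<Omega>. \<Prod>i\<in>UNIV. (if \<beta> $ i = 0 then mat 1 else adjacency_matrix (G i)) $ (x $ i) $ (y $ i))
      = of_nat (card {\<beta>\<in>\<Omega>. T \<beta>})"
    by (simp add: of_bool_def sum.If_cases Int_def)
  also have "{\<beta>\<in>\<Omega>. T \<beta>} = (if \<exists>\<beta>\<in>\<Omega>. T \<beta> then {\<gamma>} else {})"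
    using T_unique by auto
  also have "of_nat (card \<dots>) = adjacency_matrix (NEPS G \<Omega>) $ x $ y"
    by (simp add: adjacency_matrix_def NEPS_iff)
  finally show ?thesis by simp
qed

text \<open>Each Kronecker summand acts factor by factor: it multiplies factor \<open>i\<close> by
  \<open>\<mu> i\<close> on the support of \<open>\<beta>\<close> and fixes it elsewhere.\<close>

lemma NEPS_eigenvector:
  fixes G :: "'n::finite \<Rightarrow> 'v::finite \<Rightarrow> 'v \<Rightarrow> bool"
  assumes irrefl: "\<And>i a. \<not> G i a a"
    and eig: "\<And>i. adjacency_matrix (G i) *v vec_lambda (f i) = \<mu> i *s vec_lambda (f i)"
  shows "adjacency_matrix (NEPS G \<Omega>) *v tensor f
       = (\<Sum>\<beta>\<in>\<Omega>. \<Prod>i | \<beta> $ i \<noteq> 0. \<mu> i) *s tensor f"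
proof -
  define B where "B \<beta> i = (if \<beta> $ i = 0 then mat 1 else adjacency_matrix (G i))"
    for \<beta> :: "bit^'n" and i
  have B: "(\<Sum>a\<in>UNIV. B \<beta> i $ b $ a * f i a) = (if \<beta> $ i \<noteq> 0 then \<mu> i else 1) * f i b" for \<beta> i b
  proof -
    have "B \<beta> i *v vec_lambda (f i) = (if \<beta> $ i \<noteq> 0 then \<mu> i else 1) *s vec_lambda (f i)"
      using eig[of i] by (simp add: B_def)
    then show ?thesis by (simp add: vec_eq_iff matrix_vector_mult_def)
  qed
  have "(adjacency_matrix (NEPS G \<Omega>) *v tensor f) $ x
      = ((\<Sum>\<beta>\<in>\<Omega>. \<Prod>i | \<beta> $ i \<noteq> 0. \<mu> i) *s tensor f) $ x" for x
  proof -
    have "(adjacency_matrix (NEPS G \<Omega>) *v tensor f) $ x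
        = (\<Sum>y\<in>UNIV. \<Sum>\<beta>\<in>\<Omega>. \<Prod>i\<in>UNIV. B \<beta> i $ (x $ i) $ (y $ i) * f i (y $ i))"
      by (simp add: matrix_vector_mult_def adjacency_matrix_NEPS[of G, OF irrefl] B_def tensor_def
          sum_distrib_right prod.distrib)
    \<comment> \<open>After the sums are exchanged, the sum over tuples \<open>y\<close> factors
      over the coordinates.\<close>
    also have "\<dots> = (\<Sum>\<beta>\<in>\<Omega>. \<Prod>i\<in>UNIV. \<Sum>a\<in>UNIV. B \<beta> i $ (x $ i) $ a * f i a)"
      by (subst sum.swap) (simp add: sum_vec_prod[of "\<lambda>i a. B _ i $ (x $ i) $ a * f i a"])
    also have "\<dots> = (\<Sum>\<beta>\<in>\<Omega>. (\<Prod>i | \<beta> $ i \<noteq> 0. \<mu> i) * tensor f $ x)"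
      by (simp only: B prod.distrib tensor_def vec_lambda_beta)
        (simp add: prod.If_cases Collect_neg_eq[symmetric])
    finally show ?thesis by (simp add: sum_distrib_right)
  qed
  then show ?thesis by (simp add: vec_eq_iff)
qed

section \<open>Phases for the path on three vertices\<close>

text \<open>The unnormalised eigenvectors are (1, 0, -1) for \<open>s = 0\<close> and (1,
  \<plusminus>\<surd>2, 1) for \<open>s\<close> = \<plusminus>1. The integer index lets parities of
  eigenvalues be read off.\<close>

definition P3_eigenvector :: "int \<Rightarrow> 3 \<Rightarrow> complex" where
  "P3_eigenvector s x = (if x = 1 then 1 else if x = 2 then complex_of_real (sqrt 2) * of_int s
     else if s = 0 then - 1 else 1)"

lemma adjacency_matrix_P3_eigenvector:
  assumes "s \<in> {- 1, 0, 1}"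
  shows "adjacency_matrix P3 *v vec_lambda (P3_eigenvector s)
       = (complex_of_real (sqrt 2) * of_int s) *s vec_lambda (P3_eigenvector s)"
proof -
  have "complex_of_real (sqrt 2) * complex_of_real (sqrt 2) = 2"
    by (simp flip: of_real_mult)
  then show ?thesis
    using assms
    by (auto simp: vec_eq_iff matrix_vector_mult_def forall_3 sum_3 adjacency_matrix_def P3_def
        P3_eigenvector_def)
qed

lemma exp_neg_i_pi_times_int: "exp (- \<i> * (complex_of_real pi * of_int N)) = (if even N then 1 else - 1)"
proof -
  have "exp (- \<i> * (complex_of_real pi * of_int N)) = cis (- pi * of_int N)"
    by (simp add: cis_conv_exp algebra_simps)
  also have "\<dots> = (if even N then 1 else - 1)"
    by (auto simp: complex_eq_iff sin_integer_2pi cos_integer_2pi elim!: evenE oddE)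
  finally show ?thesis .
qed

text \<open>\<open>Z\<close> collects the coordinates whose factor lies in the kernel of
  \<open>P3\<close>; the other factors lie in the span of the two remaining eigenvectors. A single
  sign then serves the whole expansion of \<open>tensor f\<close>.\<close>

lemma NEPS_P3_transition:
  fixes \<Omega> :: "(bit^'n::finite) set" and Z :: "'n set"
  assumes weight: "\<forall>\<beta>\<in>\<Omega>. weight \<beta> = k"
    and f: "\<And>i x. f i x = (\<Sum>s\<in>(if i \<in> Z then {0} else {- 1, 1}). a i s * P3_eigenvector s x)"
  shows "transition_matrix (NEPS (\<lambda>_. P3) \<Omega>) (pi / sqrt 2 ^ k) *v tensor f
       = (- 1) ^ card {\<beta>\<in>\<Omega>. \<forall>i\<in>Z. \<beta> $ i = 0} *s tensor f"
proof -
  define S :: "'n \<Rightarrow> int set" where S: "S i = (if i \<in> Z then {0} else {- 1, 1})" for i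
  have f: "f = (\<lambda>i x. \<Sum>s\<in>S i. a i s * P3_eigenvector s x)"
    by (intro ext) (simp only: f S)
  let ?H = "transition_matrix (NEPS (\<lambda>_. P3) \<Omega>) (pi / sqrt 2 ^ k)"
  let ?m = "card {\<beta>\<in>\<Omega>. \<forall>i\<in>Z. \<beta> $ i = 0}"
  have "?H *v tensor (\<lambda>i. P3_eigenvector (s i)) = (- 1) ^ ?m *s tensor (\<lambda>i. P3_eigenvector (s i))"
    if s: "s \<in> PiE UNIV S" for s
  proof -
    define N where "N = (\<Sum>\<beta>\<in>\<Omega>. \<Prod>i | \<beta> $ i \<noteq> 0. s i)"
    have si: "s i \<in> S i" for i using s by auto
    have odd_s: "odd (s i) \<longleftrightarrow> i \<notin> Z" for i
      using si[of i] by (auto simp: S split: if_splits)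
    \<comment> \<open>Only odd summands affect the parity of \<open>N\<close>, and a product is odd
      exactly when the support of \<open>\<beta>\<close> avoids \<open>Z\<close>.\<close>
    have "even N \<longleftrightarrow> even (card {\<beta>\<in>\<Omega>. odd (\<Prod>i | \<beta> $ i \<noteq> 0. s i)})"
      unfolding N_def by (rule even_sum_iff) simp
    also have "{\<beta>\<in>\<Omega>. odd (\<Prod>i | \<beta> $ i \<noteq> 0. s i)} = {\<beta>\<in>\<Omega>. \<forall>i\<in>Z. \<beta> $ i = 0}"
      using odd_s by (auto simp: even_prod_iff)
    finally have parity: "even N \<longleftrightarrow> even ?m" .
    have "(\<Sum>\<beta>\<in>\<Omega>. \<Prod>i | \<beta> $ i \<noteq> 0. complex_of_real (sqrt 2) * of_int (s i))
        = (\<Sum>\<beta>\<in>\<Omega>. complex_of_real (sqrt 2) ^ k * of_int (\<Prod>i | \<beta> $ i \<noteq> 0. s i))"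
      using weight by (intro sum.cong refl) (simp add: prod.distrib weight_def)
    also have "\<dots> = complex_of_real (sqrt 2) ^ k * of_int N"
      by (simp add: N_def sum_distrib_left)
    finally have eigenvalue: "(\<Sum>\<beta>\<in>\<Omega>. \<Prod>i | \<beta> $ i \<noteq> 0. complex_of_real (sqrt 2) * of_int (s i))
        = complex_of_real (sqrt 2) ^ k * of_int N" .
    have "adjacency_matrix (NEPS (\<lambda>_. P3) \<Omega>) *v tensor (\<lambda>i. P3_eigenvector (s i))
        = (\<Sum>\<beta>\<in>\<Omega>. \<Prod>i | \<beta> $ i \<noteq> 0. complex_of_real (sqrt 2) * of_int (s i))
          *s tensor (\<lambda>i. P3_eigenvector (s i))"
    proof (rule NEPS_eigenvector)
      show "\<not> P3 a a" for a by (auto simp: P3_def)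
      show "adjacency_matrix P3 *v vec_lambda (P3_eigenvector (s i))
          = (complex_of_real (sqrt 2) * of_int (s i)) *s vec_lambda (P3_eigenvector (s i))" for i
        using si[of i] by (intro adjacency_matrix_P3_eigenvector) (auto simp: S split: if_splits)
    qed
    \<comment> \<open>The time cancels the factor \<open>sqrt 2 ^ k\<close>, leaving the phase \<pi>
      times \<open>N\<close>.\<close>
    from transition_matrix_eigenvector[OF this, of "pi / sqrt 2 ^ k"]
    have "?H *v tensor (\<lambda>i. P3_eigenvector (s i))
        = exp (- \<i> * (complex_of_real pi * of_int N)) *s tensor (\<lambda>i. P3_eigenvector (s i))"
      unfolding eigenvalue by simp
    also have "exp (- \<i> * (complex_of_real pi * of_int N)) = (- 1) ^ ?m"
      by (simp only: exp_neg_i_pi_times_int) (simp add: parity)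
    finally show ?thesis .
  qed
  then show ?thesis
    unfolding f by (subst (1 2) tensor_sum) (auto simp: S intro: matrix_vector_mult_sum_scaled)
qed

section \<open>Basis vectors through tensor products of eigenvectors\<close>

lemma P3_middle_expansion:
  "of_bool (x = 2) = (\<Sum>s\<in>{- 1, 1}. of_int s / (2 * complex_of_real (sqrt 2)) * P3_eigenvector s x)"
  using exhaust_3[of x] by (auto simp: P3_eigenvector_def field_simps)

lemma P3_ends_sum_expansion:
  "of_bool (x = 1) + of_bool (x = 3) = (\<Sum>s\<in>{- 1, 1}. 1 / 2 * P3_eigenvector s x)"
  using exhaust_3[of x] by (auto simp: P3_eigenvector_def)

lemma P3_ends_diff_expansion:
  "of_bool (x = 1) - of_bool (x = 3) = P3_eigenvector 0 x"
  using exhaust_3[of x] by (auto simp: P3_eigenvector_def)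

lemma axis_eq_tensor: "axis v 1 = tensor (\<lambda>i x. of_bool (x = v $ i))"
proof -
  have "(\<Prod>i\<in>UNIV. of_bool (x $ i = v $ i)) = (of_bool (x = v) :: complex)" for x
  proof (cases "x = v")
    case False
    then have "\<exists>i\<in>UNIV. of_bool (x $ i = v $ i) = (0 :: complex)"
      by (auto simp: vec_eq_iff)
    with False show ?thesis by (simp add: prod_zero)
  qed simp
  then show ?thesis
    by (simp add: vec_eq_iff tensor_def axis_def of_bool_def eq_commute)
qed

text \<open>Linearity in slot \<open>j\<close> makes the sum of the basis vectors at
  \<open>U_vertex j\<close> and \<open>V_vertex j\<close> a pure tensor;
  \<open>tensor_diff_at\<close> does the same for their difference.\<close>

lemma tensor_add_at:
  "tensor (\<lambda>i x. if i = j then f x + g x else h i x)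
   = tensor (\<lambda>i x. if i = j then f x else h i x) + tensor (\<lambda>i x. if i = j then g x else h i x)"
  by (simp add: vec_eq_iff tensor_def prod.If_cases distrib_right)

lemma tensor_diff_at:
  "tensor (\<lambda>i x. if i = j then f x - g x else h i x)
   = tensor (\<lambda>i x. if i = j then f x else h i x) - tensor (\<lambda>i x. if i = j then g x else h i x)"
  by (simp add: vec_eq_iff tensor_def prod.If_cases left_diff_distrib)

lemma axis_U_vertex:
  "axis (U_vertex j) 1 = tensor (\<lambda>i x. if i = j then of_bool (x = 1) else of_bool (x = 2))"
  unfolding axis_eq_tensor by (rule arg_cong[of _ _ tensor]) (auto simp: fun_eq_iff U_vertex_def)

lemma axis_V_vertex:
  "axis (V_vertex j) 1 = tensor (\<lambda>i x. if i = j then of_bool (x = 3) else of_bool (x = 2))"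
  unfolding axis_eq_tensor by (rule arg_cong[of _ _ tensor]) (auto simp: fun_eq_iff V_vertex_def)

section \<open>Parity of the column sums and the transfer dichotomy\<close>

lemma sum_bit_eq_0_iff:
  fixes \<Omega> :: "(bit^'n::finite) set"
  shows "(\<Sum>\<beta>\<in>\<Omega>. \<beta> $ j) = 0 \<longleftrightarrow> even (card {\<beta>\<in>\<Omega>. \<beta> $ j \<noteq> 0})"
proof -
  have "even b \<longleftrightarrow> b = 0" for b :: bit
    by (cases b) simp_all
  then show ?thesis
    using even_sum_iff[of \<Omega> "\<lambda>\<beta>. \<beta> $ j"] by simp
qed

theorem theorem4p3:
  fixes \<Omega> :: "(bit^'n::finite) set" and k :: nat and \<tau> :: real
  assumes nonzero: "\<forall>\<beta>\<in>\<Omega>. \<beta> \<noteq> 0"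
    and weight: "\<forall>\<beta>\<in>\<Omega>. weight \<beta> = k"
    and tau: "\<tau> = pi / (sqrt 2) ^ k"
  shows "(\<forall>j. (\<Sum>\<beta>\<in>\<Omega>. \<beta> $ j) \<noteq> 0 \<longrightarrow>
            perfect_state_transfer (NEPS (\<lambda>_. P3) \<Omega>) (U_vertex j) (V_vertex j) \<tau> \<and>
            perfect_state_transfer (NEPS (\<lambda>_. P3) \<Omega>) (V_vertex j) (U_vertex j) \<tau>) \<and>
         (\<forall>j. (\<Sum>\<beta>\<in>\<Omega>. \<beta> $ j) = 0 \<longrightarrow>
            periodic_at (NEPS (\<lambda>_. P3) \<Omega>) (U_vertex j) \<tau> \<and>
            periodic_at (NEPS (\<lambda>_. P3) \<Omega>) (V_vertex j) \<tau>) \<and>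
         periodic_at (NEPS (\<lambda>_. P3) \<Omega>) (\<chi> i. 2) \<tau>"
proof -
  let ?H = "transition_matrix (NEPS (\<lambda>_. P3) \<Omega>) \<tau>"
  \<comment> \<open>The phase for \<open>Z = {}\<close>, where every \<open>\<beta>\<close> in
    \<open>\<Omega>\<close> is counted.\<close>
  define \<sigma> :: complex where "\<sigma> = (- 1) ^ card \<Omega>"
  have norm_\<sigma>: "norm \<sigma> = 1" by (simp add: \<sigma>_def norm_power)
  have coeff: "?H $ u $ v = (?H *v axis v 1) $ u" for u v
    by (simp add: matrix_vector_mult_def axis_def if_distrib cong: if_cong)
  have "?H *v axis (\<chi> i. 2) 1 = \<sigma> *s axis (\<chi> i. 2) 1"
    using NEPS_P3_transition[OF weight, where f = "\<lambda>_ x. of_bool (x = 2)" and Z = "{}"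
        and a = "\<lambda>_ s. of_int s / (2 * complex_of_real (sqrt 2))"]
    by (simp add: P3_middle_expansion axis_eq_tensor tau \<sigma>_def)
  then have middle: "periodic_at (NEPS (\<lambda>_. P3) \<Omega>) (\<chi> i. 2) \<tau>"
    by (simp add: periodic_at_def matrix_coeff_eq coeff norm_\<sigma>)
  \<comment> \<open>Up to the phase \<open>\<sigma>\<close>, the evolution fixes both vertices if
    \<open>m\<close> is even and swaps them if \<open>m\<close> is odd.\<close>
  have transfer:
    "?H *v axis (U_vertex j) 1 = \<sigma> *s axis (if even m then U_vertex j else V_vertex j) 1"
    "?H *v axis (V_vertex j) 1 = \<sigma> *s axis (if even m then V_vertex j else U_vertex j) 1"
    if m: "m = card {\<beta>\<in>\<Omega>. \<beta> $ j \<noteq> 0}" for j m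
  proof -
    let ?U = "axis (U_vertex j) (1::complex)" and ?V = "axis (V_vertex j) (1::complex)"
    let ?m' = "card {\<beta>\<in>\<Omega>. \<beta> $ j = 0}"
    \<comment> \<open>For \<open>Z = {j}\<close> the sign exponent is \<open>?m'\<close>; it differs
      from \<open>card \<Omega>\<close> by \<open>m\<close>.\<close>
    have "card \<Omega> = ?m' + m"
      unfolding m by (subst card_Un_disjoint[symmetric]) (auto intro: arg_cong[of _ _ card])
    then have sign: "(- 1) ^ ?m' = \<sigma> * (- 1) ^ m"
      by (simp add: \<sigma>_def power_add mult.assoc flip: power_mult_distrib)
    \<comment> \<open>The symmetric combination has no kernel component at \<open>j\<close>, so
      \<open>Z = {}\<close>.\<close>
    have "(if i = j then of_bool (x = 1) + of_bool (x = 3) else of_bool (x = 2))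
        = (\<Sum>s\<in>(if i \<in> {} then {0} else {- 1, 1}).
            (if i = j then 1 / 2 else of_int s / (2 * complex_of_real (sqrt 2))) * P3_eigenvector s x)"
      for i x by (simp add: P3_middle_expansion P3_ends_sum_expansion)
    from NEPS_P3_transition[OF weight this]
    have "?H *v (?U + ?V) = \<sigma> *s (?U + ?V)"
      unfolding axis_U_vertex axis_V_vertex tensor_add_at[symmetric]
      by (simp add: tau \<sigma>_def)
    then have sum: "?H *v ?U + ?H *v ?V = \<sigma> *s (?U + ?V)"
      by (simp add: matrix_vector_right_distrib)
    \<comment> \<open>The antisymmetric combination is the kernel eigenvector at \<open>j\<close>,
      so \<open>Z = {j}\<close>.\<close>
    have "(if i = j then of_bool (x = 1) - of_bool (x = 3) else of_bool (x = 2))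
        = (\<Sum>s\<in>(if i \<in> {j} then {0} else {- 1, 1}).
            (if i = j then 1 else of_int s / (2 * complex_of_real (sqrt 2))) * P3_eigenvector s x)"
      for i x by (simp add: P3_middle_expansion P3_ends_diff_expansion)
    from NEPS_P3_transition[OF weight this]
    have "?H *v (?U - ?V) = (\<sigma> * (- 1) ^ m) *s (?U - ?V)"
      unfolding axis_U_vertex axis_V_vertex tensor_diff_at[symmetric] sign[symmetric]
      by (simp add: tau)
    then have diff: "?H *v ?U - ?H *v ?V = (\<sigma> * (- 1) ^ m) *s (?U - ?V)"
      by (simp add: matrix_vector_mult_diff_distrib)
    \<comment> \<open>The separate images are half the sum and half the difference of the two known
      ones.\<close>
    have "2 *s (?H *v ?U) = (?H *v ?U + ?H *v ?V) + (?H *v ?U - ?H *v ?V)"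
      "2 *s (?H *v ?V) = (?H *v ?U + ?H *v ?V) - (?H *v ?U - ?H *v ?V)"
      by (simp_all add: vec_eq_iff)
    then show
      "?H *v ?U = \<sigma> *s axis (if even m then U_vertex j else V_vertex j) 1"
      "?H *v ?V = \<sigma> *s axis (if even m then V_vertex j else U_vertex j) 1"
      unfolding sum diff by (auto simp: vec_eq_iff algebra_simps)
  qed
  show ?thesis
    using middle
    by (auto simp: perfect_state_transfer_def periodic_at_def matrix_coeff_eq coeff norm_\<sigma>
        transfer[OF refl] sum_bit_eq_0_iff)
qed

end
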